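(* Let $\mathcal M$ and $\mathcal M'$ be finite irreducible Markov chains on the same state space $V$, $|V|\ge2$, with kernels $P,P'$, stationary distributions $\pi,\pi'$, and edge sets $E,E'$ respectively. To every edge $(x,y)\in E'$ associate a path $\gamma_{xy}\subset E$ from $x$ to $y$. Let $$\rho_e=\max_{e\in E}\frac{1}{Q(e)}\sum_{\gamma_{xy}\ni e}\pi'(x)P'(x,y)\quad\text{and}\quad \rho_v=\max_{v\in V}\frac{1}{\pi(v)}\sum_{\gamma_{xy}\ni v}\pi'(x)P'(x,y).$$ If $\mathcal M$ is lazy, $A\subset V$ is a nonempty proper subset, and $f:[0,1]\to[0,\infty)$ is a concave function with $f(\pi(A))\ne0$, then $$1-\mathcal C_f(A)\ge 2\,\frac{\rho_v}{\rho_e}\left(1-\frac{f\left(\pi(A)+\frac{Q'(A,A^c)}{\rho_v}\right)+f\left(\pi(A)-\frac{Q'(A,A^c)}{\rho_v}\right)}{2f(\pi(A))}\right).$$ Moreover, the same conclusion holds if in the sum defining $\rho_v$, whenever both paths $\gamma_{xy}$ and $\gamma_{yx}$ pass through the vertex $v$, the sum of weights $\pi'(x)P'(x,y)+\pi'(y)P'(y,x)$ is replaced by $\max\{\pi'(x)P'(x,y),\pi'(y)P'(y,x)\}$.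
   Context: Lazy means $P(x,x)\ge1/2$ for all $x\in V$. $E=\{(x,y):P(x,y)>0\}$, $E'=\{(x,y):P'(x,y)>0\}$ are directed edges; a path $\gamma_{xy}\subset E$ is a sequence of consecutive directed edges of $E$ from $x$ to $y$ (possibly trivial if $x=y$). The sums are over $(x,y)\in E'$ whose path uses the edge $e$, respectively visits the vertex $v$ (endpoints $x,y$ count as visited). $Q(e)=\pi(u)P(u,v)$ for $e=(u,v)$; $Q(A,B)=\sum_{x\in A,y\in B}\pi(x)P(x,y)$, $Q(A,y)=Q(A,\{y\})$, $Q'(A,B)=\sum_{x\in A,y\in B}\pi'(x)P'(x,y)$. For the chain $\mathcal M$: $A_u=\{y\in V:Q(A,y)\ge u\,\pi(y)\}$, $u\in[0,1]$, and $\mathcal C_f(A)=\frac{\int_0^1 f(\pi(A_u))\,du}{f(\pi(A))}$. *)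

theory Defs
  imports "HOL-Probability.Probability" "Graph_Theory.Arc_Walk"
begin

text \<open>
  A Markov chain on a finite state space \<open>'v\<close> is given by its kernel
  \<open>P :: 'v \<Rightarrow> 'v pmf\<close>, where \<open>pmf (P x) y\<close> is the transition probability from \<open>x\<close> to \<open>y\<close>.
\<close>

definition step_dist :: "('v \<Rightarrow> 'v pmf) \<Rightarrow> nat \<Rightarrow> 'v \<Rightarrow> 'v pmf" where
  "step_dist P n x = ((\<lambda>\<mu>. bind_pmf \<mu> P) ^^ n) (return_pmf x)"

definition irreducible_chain :: "('v \<Rightarrow> 'v pmf) \<Rightarrow> bool" where
  "irreducible_chain P \<longleftrightarrow> (\<forall>x y. \<exists>n. pmf (step_dist P n x) y > 0)"

definition stationary :: "('v \<Rightarrow> 'v pmf) \<Rightarrow> 'v pmf \<Rightarrow> bool" where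
  "stationary P \<pi> \<longleftrightarrow> bind_pmf \<pi> P = \<pi>"

definition lazy_chain :: "('v \<Rightarrow> 'v pmf) \<Rightarrow> bool" where
  "lazy_chain P \<longleftrightarrow> (\<forall>x. pmf (P x) x \<ge> 1 / 2)"

definition edge_set :: "('v \<Rightarrow> 'v pmf) \<Rightarrow> ('v \<times> 'v) set" where
  "edge_set P = {(x, y). pmf (P x) y > 0}"

definition edge_weight :: "('v \<Rightarrow> 'v pmf) \<Rightarrow> 'v pmf \<Rightarrow> 'v \<times> 'v \<Rightarrow> real" where
  "edge_weight P \<pi> e = pmf \<pi> (fst e) * pmf (P (fst e)) (snd e)"

definition flow :: "('v \<Rightarrow> 'v pmf) \<Rightarrow> 'v pmf \<Rightarrow> 'v set \<Rightarrow> 'v set \<Rightarrow> real" where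
  "flow P \<pi> A B = (\<Sum>x\<in>A. \<Sum>y\<in>B. pmf \<pi> x * pmf (P x) y)"

definition evolve :: "('v \<Rightarrow> 'v pmf) \<Rightarrow> 'v pmf \<Rightarrow> 'v set \<Rightarrow> real \<Rightarrow> 'v set" where
  "evolve P \<pi> A u = {y. flow P \<pi> A {y} \<ge> u * pmf \<pi> y}"

definition C_profile ::
  "('v \<Rightarrow> 'v pmf) \<Rightarrow> 'v pmf \<Rightarrow> (real \<Rightarrow> real) \<Rightarrow> 'v set \<Rightarrow> real" where
  "C_profile P \<pi> f A =
     integral {0..1} (\<lambda>u. f (measure_pmf.prob \<pi> (evolve P \<pi> A u))) / f (measure_pmf.prob \<pi> A)"

definition chain_graph :: "('v \<Rightarrow> 'v pmf) \<Rightarrow> ('v, 'v \<times> 'v) pre_digraph" where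
  "chain_graph P = \<lparr>verts = UNIV, arcs = edge_set P, tail = fst, head = snd\<rparr>"

text \<open>
  Paths are arc lists, with no requirement of being simple; the empty list is the trivial
  path at a vertex, so that only pairs \<open>(x, x)\<close> may be assigned it.  Values of \<open>\<gamma>\<close> outside
  the edge set of \<open>P'\<close> are irrelevant.
\<close>

definition path_system ::
  "('v \<Rightarrow> 'v pmf) \<Rightarrow> ('v \<Rightarrow> 'v pmf) \<Rightarrow> ('v \<Rightarrow> 'v \<Rightarrow> ('v \<times> 'v) list) \<Rightarrow> bool" where
  "path_system P P' \<gamma> \<longleftrightarrow>
     (\<forall>(x, y)\<in>edge_set P'. pre_digraph.awalk (chain_graph P) x (\<gamma> x y) y)"

definition pairs_via_edge ::
  "('v \<Rightarrow> 'v pmf) \<Rightarrow> ('v \<Rightarrow> 'v \<Rightarrow> ('v \<times> 'v) list) \<Rightarrow> 'v \<times> 'v \<Rightarrow> ('v \<times> 'v) set" where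
  "pairs_via_edge P' \<gamma> e = {(x, y) \<in> edge_set P'. e \<in> set (\<gamma> x y)}"

definition pairs_via_vertex ::
  "('v \<Rightarrow> 'v pmf) \<Rightarrow> ('v \<Rightarrow> 'v pmf) \<Rightarrow> ('v \<Rightarrow> 'v \<Rightarrow> ('v \<times> 'v) list) \<Rightarrow> 'v \<Rightarrow> ('v \<times> 'v) set" where
  "pairs_via_vertex P P' \<gamma> v =
     {(x, y) \<in> edge_set P'. v \<in> set (pre_digraph.awalk_verts (chain_graph P) x (\<gamma> x y))}"

definition rho_edge ::
  "('v::finite \<Rightarrow> 'v pmf) \<Rightarrow> 'v pmf \<Rightarrow> ('v \<Rightarrow> 'v pmf) \<Rightarrow> 'v pmf \<Rightarrow>
    ('v \<Rightarrow> 'v \<Rightarrow> ('v \<times> 'v) list) \<Rightarrow> real" where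
  "rho_edge P \<pi> P' \<pi>' \<gamma> =
     (MAX e\<in>edge_set P.
        1 / edge_weight P \<pi> e * (\<Sum>d\<in>pairs_via_edge P' \<gamma> e. edge_weight P' \<pi>' d))"

definition rho_vertex ::
  "('v::finite \<Rightarrow> 'v pmf) \<Rightarrow> 'v pmf \<Rightarrow> ('v \<Rightarrow> 'v pmf) \<Rightarrow> 'v pmf \<Rightarrow>
    ('v \<Rightarrow> 'v \<Rightarrow> ('v \<times> 'v) list) \<Rightarrow> real" where
  "rho_vertex P \<pi> P' \<pi>' \<gamma> =
     (MAX v\<in>UNIV.
        1 / pmf \<pi> v * (\<Sum>d\<in>pairs_via_vertex P P' \<gamma> v. edge_weight P' \<pi>' d))"

text \<open>
  In the variant below the pairs whose path visits \<open>v\<close> are grouped by their underlying unordered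
  pair \<open>S\<close>, and each group contributes the maximum of its (one or two) weights: the maximum of
  the two weights if both orientations visit \<open>v\<close>, and the single weight otherwise.
\<close>

definition rho_vertex_max ::
  "('v::finite \<Rightarrow> 'v pmf) \<Rightarrow> 'v pmf \<Rightarrow> ('v \<Rightarrow> 'v pmf) \<Rightarrow> 'v pmf \<Rightarrow>
    ('v \<Rightarrow> 'v \<Rightarrow> ('v \<times> 'v) list) \<Rightarrow> real" where
  "rho_vertex_max P \<pi> P' \<pi>' \<gamma> =
     (MAX v\<in>UNIV.
        1 / pmf \<pi> v *
          (\<Sum>S\<in>(\<lambda>(x, y). {x, y}) ` pairs_via_vertex P P' \<gamma> v.
             MAX d\<in>{(x, y) \<in> pairs_via_vertex P P' \<gamma> v. {x, y} = S}. edge_weight P' \<pi>' d))"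

end

theory Submission
  imports Defs
begin

text \<open>
  The area \<open>F c = \<integral>\<^sub>0\<^sup>c \<pi>(A\<^sub>u) du\<close> equals \<open>\<Sum>\<^sub>y min (c \<pi>(y)) (Q(A, y))\<close>.  Every path from \<open>A\<close> to its
  complement crosses by an edge whose head \<open>y\<close> lies outside \<open>A\<close>; the paths with a given \<open>y\<close> carry
  weight at most \<open>min (\<rho>\<^sub>v \<pi>(y)) (\<rho>\<^sub>e Q(A, y))\<close>.  With \<open>s = \<rho>\<^sub>v / \<rho>\<^sub>e\<close> this says that the excess of
  \<open>\<pi>(A\<^sub>u)\<close> over \<open>\<pi>(A)\<close> averages at least \<open>Q'(A, A\<^sup>c) / \<rho>\<^sub>v\<close> on \<open>[0, s]\<close>, and by the same argument for
  \<open>A\<^sup>c\<close> the deficit does so on \<open>[1 - s, 1]\<close>.  As the mean of \<open>\<pi>(A\<^sub>u)\<close> over \<open>[0, 1]\<close> is \<open>\<pi>(A)\<close>, Jensen's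
  inequality yields the claim when \<open>s \<le> 1 / 2\<close>.  For \<open>s > 1 / 2\<close> laziness allows \<open>\<rho>\<^sub>v\<close> to be lowered to
  \<open>\<rho>\<^sub>e / 2\<close>, and concavity of \<open>f\<close> shows that this only strengthens the bound.
\<close>

section \<open>Integrals and Jensen's inequality for functions of finite range\<close>

text \<open>On each level set of \<open>X\<close> the composite is constant, so it is a finite
  combination of indicators and is integrable for every \<open>g\<close>. This covers a concave
  \<open>f\<close> that jumps at an endpoint.\<close>

lemma has_integral_finite_range:
  fixes X g :: "real \<Rightarrow> real"
  assumes "finite (range X)" and "X \<in> borel_measurable borel"
  shows "((\<lambda>u. g (X u)) has_integral
           (\<Sum>c\<in>range X. g c * measure lebesgue (X -` {c} \<inter> {l..r}))) {l..r}"
proof -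
  have "((\<lambda>u. \<Sum>c\<in>range X. g c * indicator (X -` {c} \<inter> {l..r}) u) has_integral
           (\<Sum>c\<in>range X. g c * measure lebesgue (X -` {c} \<inter> {l..r}))) {l..r}"
  proof (intro has_integral_sum assms(1) has_integral_mult_right)
    fix c assume "c \<in> range X"
    have "X -` {c} \<in> sets borel"
      using measurable_sets[OF assms(2), of "{c}"] by simp
    then have "X -` {c} \<inter> {l..r} \<in> sets borel"
      by simp
    then have "X -` {c} \<inter> {l..r} \<in> lmeasurable"
      by (intro bounded_set_imp_lmeasurable bounded_Int) auto
    then have "((\<lambda>_. 1) has_integral measure lebesgue (X -` {c} \<inter> {l..r})) (X -` {c} \<inter> {l..r})"
      by (simp add: lmeasure_integral lmeasurable_iff_integrable_on has_integral_integral)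
    then have "((\<lambda>u. if u \<in> X -` {c} \<inter> {l..r} then 1 else 0) has_integral
                 measure lebesgue (X -` {c} \<inter> {l..r})) {l..r}"
      by (subst has_integral_restrict) auto
    then show "(indicator (X -` {c} \<inter> {l..r}) has_integral
                 measure lebesgue (X -` {c} \<inter> {l..r})) {l..r}"
      by (simp add: indicator_def[abs_def] of_bool_def)
  qed
  moreover have "(\<Sum>c\<in>range X. g c * indicator (X -` {c} \<inter> {l..r}) u) = g (X u)" if "u \<in> {l..r}" for u
  proof -
    have "(\<Sum>c\<in>range X. g c * indicator (X -` {c} \<inter> {l..r}) u) = (\<Sum>c\<in>range X. if X u = c then g c else 0)"
      using that by (intro sum.cong) (auto simp: indicator_def)
    then show ?thesis
      using assms(1) by (simp add: sum.delta)
  qed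
  ultimately show ?thesis
    by (rule has_integral_eq[rotated])
qed

text \<open>The interval \<open>S\<close> need not be open and \<open>f\<close> may jump at its endpoints, which the library's
  Jensen inequality for expectations excludes.\<close>

lemma jensen_finite_range:
  fixes X f :: "real \<Rightarrow> real"
  assumes "finite (range X)" and "X \<in> borel_measurable borel"
    and "concave_on S f" and "range X \<subseteq> S"
    and "l < r" and I: "(X has_integral I) {l..r}"
  shows "I / (r - l) \<in> S" and "integral {l..r} (\<lambda>u. f (X u)) \<le> (r - l) * f (I / (r - l))"
proof -
  \<comment> \<open>The \<open>m c\<close> are the relative lengths of the level sets. They are the
    weights of a convex combination of the values of \<open>X\<close> with mean
    \<open>I / (r - l)\<close>, to which the finite Jensen inequality applies.\<close>
  define m where "m c = measure lebesgue (X -` {c} \<inter> {l..r}) / (r - l)" for c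
  have m: "measure lebesgue (X -` {c} \<inter> {l..r}) = (r - l) * m c" for c
    using \<open>l < r\<close> by (simp add: m_def)
  have fin: "((\<lambda>u. g (X u)) has_integral (r - l) * (\<Sum>c\<in>range X. m c * g c)) {l..r}" for g
    using has_integral_finite_range[OF assms(1,2), of g l r]
    by (simp add: m sum_distrib_left mult_ac)
  have "((\<lambda>_. 1::real) has_integral (r - l)) {l..r}"
    using has_integral_const_real[of "1::real" l r] \<open>l < r\<close> by simp
  with fin[of "\<lambda>_. 1"] have one: "sum m (range X) = 1"
    using \<open>l < r\<close> by (auto dest: has_integral_unique)
  have mean: "I / (r - l) = (\<Sum>c\<in>range X. m c *\<^sub>R c)"
    using has_integral_unique[OF I fin[of "\<lambda>c. c"]] \<open>l < r\<close> by simp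
  have nn: "m c \<ge> 0" for c
    using \<open>l < r\<close> by (simp add: m_def)
  have "convex S"
    using assms(3) by (rule concave_on_imp_convex)
  then show "I / (r - l) \<in> S"
    unfolding mean using assms(1,4) one nn by (intro convex_sum) auto
  have "(\<Sum>c\<in>range X. m c * f c) \<le> f (I / (r - l))"
    unfolding mean using assms(1,4) one nn by (intro concave_on_sum[OF _ _ assms(3)]) auto
  then show "integral {l..r} (\<lambda>u. f (X u)) \<le> (r - l) * f (I / (r - l))"
    using integral_unique[OF fin[of f]] \<open>l < r\<close> by simp
qed

section \<open>Supporting lines of concave functions and the spread inequality\<close>

lemma concave_on_supergradient:
  fixes f :: "real \<Rightarrow> real"
  assumes "concave_on {p..q} f" and "a \<in> {p<..<q}"
  obtains m where "\<And>x. x \<in> {p..q} \<Longrightarrow> f x \<le> f a + m * (x - a)"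
proof -
  \<comment> \<open>This is the right derivative at \<open>a\<close> of the convex function
    \<open>- f\<close>, written as the infimum of its difference quotients over points to the right
    of \<open>a\<close>.\<close>
  let ?k = "Inf ((\<lambda>t. ((\<lambda>x. - f x) a - (\<lambda>x. - f x) t) / (a - t)) ` ({a<..} \<inter> {p..q}))"
  have "(\<lambda>x. - f x) x \<ge> (\<lambda>x. - f x) a + ?k * (x - a)" if "x \<in> {p..q}" for x
    using assms that by (intro convex_le_Inf_differential) (auto simp: concave_on_def)
  then have "f x \<le> f a + (- ?k) * (x - a)" if "x \<in> {p..q}" for x
    using that by fastforce
  then show thesis by (rule that)
qed

text \<open>Concavity puts \<open>f b\<close> above the chord from \<open>a\<close> to
  \<open>p\<close>, and the supporting line at \<open>a\<close> bounds \<open>f p\<close>.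
  Eliminating \<open>f a\<close> shows that the slope \<open>m\<close> still bounds the growth of
  \<open>f\<close> when one starts from \<open>b\<close> and moves further away from
  \<open>a\<close>.\<close>

lemma concave_on_extrapolate:
  fixes f :: "real \<Rightarrow> real"
  assumes "concave_on S f" and m: "\<And>x. x \<in> S \<Longrightarrow> f x \<le> f a + m * (x - a)"
    and "a \<in> S" "p \<in> S" and b: "a \<le> b \<and> b \<le> p \<or> p \<le> b \<and> b \<le> a"
  shows "f p \<le> f b + m * (p - b)"
proof (cases "p = a")
  case True
  then show ?thesis using b by auto
next
  case False
  define \<theta> where "\<theta> = (b - a) / (p - a)"
  have "0 \<le> \<theta>" "\<theta> \<le> 1" and \<theta>: "\<theta> * (p - a) = b - a"
    using b False by (auto simp: \<theta>_def divide_simps)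
  from \<theta> have beq: "b = (1 - \<theta>) * a + \<theta> * p"
    by (simp add: algebra_simps)
  then have "(1 - \<theta>) * f a + \<theta> * f p \<le> f b"
    using concave_onD[OF assms(1) \<open>0 \<le> \<theta>\<close> \<open>\<theta> \<le> 1\<close> \<open>a \<in> S\<close> \<open>p \<in> S\<close>] by simp
  moreover have "(1 - \<theta>) * f p \<le> (1 - \<theta>) * (f a + m * (p - a))"
    using m[OF \<open>p \<in> S\<close>] \<open>\<theta> \<le> 1\<close> by (intro mult_left_mono) auto
  moreover have "m * (p - b) = (1 - \<theta>) * (m * (p - a))"
    by (simp add: beq algebra_simps)
  ultimately show ?thesis by (simp add: algebra_simps)
qed

text \<open>Jensen's inequality is applied on \<open>[0, s]\<close> and on \<open>[1 - s, 1]\<close>; the slope \<open>m\<close> of a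
  supporting line at \<open>a\<close> compares the three pieces, because the means \<open>I\<^sub>1 / s\<close> and \<open>I\<^sub>3 / s\<close> lie
  outside \<open>(a - t, a + t)\<close>.\<close>

lemma integral_concave_le_spread:
  fixes X f :: "real \<Rightarrow> real"
  assumes X: "finite (range X)" "X \<in> borel_measurable borel" "range X \<subseteq> {0..1}"
    and f: "concave_on {0..1} f"
    and a: "a \<in> {0<..<1}" "0 \<le> s" "s \<le> 1 / 2" "0 \<le> t"
    and I1: "(X has_integral I\<^sub>1) {0..s}" "s * (a + t) \<le> I\<^sub>1"
    and I2: "(X has_integral I\<^sub>2) {s..1 - s}"
    and I3: "(X has_integral I\<^sub>3) {1 - s..1}" "I\<^sub>3 \<le> s * (a - t)"
    and sum: "I\<^sub>1 + I\<^sub>2 + I\<^sub>3 = a"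
    and pos: "s > 0"
  shows "a + t \<le> 1" and "0 \<le> a - t"
    and "integral {0..1} (\<lambda>u. f (X u)) \<le> (1 - 2 * s) * f a + s * (f (a + t) + f (a - t))"
proof -
  have int: "(\<lambda>u. f (X u)) integrable_on {l..r}" for l r
    using has_integral_finite_range[OF X(1,2)] by blast
  obtain m where m: "\<And>x. x \<in> {0..1} \<Longrightarrow> f x \<le> f a + m * (x - a)"
    using concave_on_supergradient[OF f a(1)] by blast
  note j1 = jensen_finite_range[OF X(1,2) f X(3) pos I1(1)]
  have "1 - s < 1" using pos by simp
  note j3 = jensen_finite_range[OF X(1,2) f X(3) \<open>1 - s < 1\<close> I3(1)]
  have le1: "a + t \<le> I\<^sub>1 / s" and le3: "I\<^sub>3 / s \<le> a - t"
    using I1(2) I3(2) pos by (simp_all add: field_simps)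
  then show "a + t \<le> 1" "0 \<le> a - t"
    using j1(1) j3(1) by simp_all
  have "f (I\<^sub>1 / s) \<le> f (a + t) + m * (I\<^sub>1 / s - (a + t))"
    using j1(1) le1 a by (intro concave_on_extrapolate[OF f m]) auto
  then have "s * f (I\<^sub>1 / s) \<le> s * (f (a + t) + m * (I\<^sub>1 / s - (a + t)))"
    using pos by (intro mult_left_mono) auto
  also have "\<dots> = s * f (a + t) + m * (I\<^sub>1 - s * (a + t))"
    using pos by (simp add: field_simps)
  finally have b1: "integral {0..s} (\<lambda>u. f (X u)) \<le> s * f (a + t) + m * (I\<^sub>1 - s * (a + t))"
    using j1(2) by simp
  have "f (I\<^sub>3 / s) \<le> f (a - t) + m * (I\<^sub>3 / s - (a - t))"
    using j3(1) le3 a by (intro concave_on_extrapolate[OF f m]) auto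
  then have "s * f (I\<^sub>3 / s) \<le> s * (f (a - t) + m * (I\<^sub>3 / s - (a - t)))"
    using pos by (intro mult_left_mono) auto
  also have "\<dots> = s * f (a - t) + m * (I\<^sub>3 - s * (a - t))"
    using pos by (simp add: field_simps)
  finally have b3: "integral {1 - s..1} (\<lambda>u. f (X u)) \<le> s * f (a - t) + m * (I\<^sub>3 - s * (a - t))"
    using j3(2) by simp
  \<comment> \<open>On the middle piece the supporting line at \<open>a\<close> suffices; its
    integral is linear in that of \<open>X\<close>.\<close>
  have "((\<lambda>u. (f a - m * a) + m * X u) has_integral (1 - 2 * s) * (f a - m * a) + m * I\<^sub>2) {s..1 - s}"
    using a by (intro has_integral_add has_integral_mult_right I2 has_integral_eq_rhs[OF has_integral_const_real]) auto
  moreover have "f (X u) \<le> (f a - m * a) + m * X u" for u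
  proof -
    have "X u \<in> {0..1}" using X(3) by blast
    then show ?thesis using m[of "X u"] by (simp add: algebra_simps)
  qed
  ultimately have b2: "integral {s..1 - s} (\<lambda>u. f (X u)) \<le> (1 - 2 * s) * (f a - m * a) + m * I\<^sub>2"
    using has_integral_le[OF integrable_integral[OF int]] by blast
  have "integral {0..1} (\<lambda>u. f (X u)) = integral {0..s} (\<lambda>u. f (X u))
          + integral {s..1 - s} (\<lambda>u. f (X u)) + integral {1 - s..1} (\<lambda>u. f (X u))"
    using Henstock_Kurzweil_Integration.integral_combine[OF _ _ int, of 0 s 1]
      Henstock_Kurzweil_Integration.integral_combine[OF _ _ int, of s "1 - s" 1] a by simp
  \<comment> \<open>The corrections carrying the slope \<open>m\<close> add up to a multiple of the
    total integral of \<open>X\<close> minus \<open>a\<close>, which vanishes by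
    \<open>sum\<close>.\<close>
  also have "\<dots> \<le> (1 - 2 * s) * f a + s * (f (a + t) + f (a - t)) + m * (I\<^sub>1 + I\<^sub>2 + I\<^sub>3 - a)"
    using b1 b2 b3 by (simp add: algebra_simps)
  finally show "integral {0..1} (\<lambda>u. f (X u)) \<le> (1 - 2 * s) * f a + s * (f (a + t) + f (a - t))"
    by (simp add: sum)
qed

section \<open>Stationary distributions and flows\<close>

lemma stationary_sum:
  fixes P :: "'v::finite \<Rightarrow> 'v pmf"
  assumes "stationary P \<pi>"
  shows "(\<Sum>x\<in>UNIV. pmf \<pi> x * pmf (P x) y) = pmf \<pi> y"
proof -
  have "pmf \<pi> y = pmf (bind_pmf \<pi> P) y"
    using assms by (simp add: stationary_def)
  also have "\<dots> = (\<Sum>x\<in>UNIV. pmf \<pi> x * pmf (P x) y)"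
    by (simp add: pmf_bind integral_measure_pmf_real[where A = UNIV] mult.commute)
  finally show ?thesis by simp
qed

text \<open>Stationarity passes to every \<open>n\<close>-step kernel, so the support of \<pi> is
  closed under reachability. As it is nonempty, irreducibility makes it the whole space.\<close>

lemma stationary_pmf_pos:
  fixes P :: "'v::finite \<Rightarrow> 'v pmf"
  assumes "irreducible_chain P" and "stationary P \<pi>"
  shows "pmf \<pi> y > 0"
proof -
  obtain x where x: "x \<in> set_pmf \<pi>"
    using set_pmf_not_empty[of \<pi>] by blast
  obtain n where n: "pmf (step_dist P n x) y > 0"
    using assms(1) by (auto simp: irreducible_chain_def)
  have "bind_pmf \<pi> (step_dist P k) = \<pi>" for k
  proof (induction k)
    case 0
    then show ?case by (simp add: step_dist_def bind_return_pmf')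
  next
    case (Suc k)
    have "bind_pmf \<pi> (step_dist P (Suc k)) = bind_pmf (bind_pmf \<pi> (step_dist P k)) P"
      by (simp add: step_dist_def[abs_def] bind_assoc_pmf)
    then show ?case
      using Suc assms(2) by (simp add: stationary_def)
  qed
  then have "set_pmf \<pi> = (\<Union>z\<in>set_pmf \<pi>. set_pmf (step_dist P n z))"
    by (metis set_bind_pmf)
  then have "y \<in> set_pmf \<pi>"
    using x n by (auto simp: pmf_positive_iff)
  then show ?thesis by (simp add: pmf_positive)
qed

lemma sum_Compl:
  fixes g :: "'a::finite \<Rightarrow> real"
  shows "sum g A + sum g (- A) = sum g UNIV"
  using sum.subset_diff[of A UNIV g] by (simp add: Compl_eq_Diff_UNIV add.commute)

lemma flow_nonneg: "flow P \<pi> A B \<ge> 0"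
  by (simp add: flow_def sum_nonneg)

lemma flow_singleton: "flow P \<pi> A {y} = (\<Sum>x\<in>A. pmf \<pi> x * pmf (P x) y)"
  by (simp add: flow_def)

lemma sum_flow_singleton:
  fixes P :: "'v::finite \<Rightarrow> 'v pmf"
  shows "(\<Sum>y\<in>B. flow P \<pi> A {y}) = flow P \<pi> A B"
  by (simp only: flow_singleton flow_def[of P \<pi> A B]) (rule sum.swap)

lemma flow_Compl:
  fixes P :: "'v::finite \<Rightarrow> 'v pmf"
  assumes "stationary P \<pi>"
  shows "flow P \<pi> A {y} + flow P \<pi> (- A) {y} = pmf \<pi> y"
  by (simp add: flow_singleton sum_Compl stationary_sum[OF assms])

lemma flow_UNIV:
  fixes P :: "'v::finite \<Rightarrow> 'v pmf"
  shows "flow P \<pi> A UNIV = measure_pmf.prob \<pi> A"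
  by (simp add: flow_def measure_measure_pmf_finite flip: sum_distrib_left)
    (simp add: sum_pmf_eq_1)

text \<open>Each of the two flows complements \<open>flow P \<pi> A A\<close> to \<pi>(A): the
  inflow by stationarity, the outflow because the transition probabilities from each vertex sum to
  1.\<close>

lemma flow_cut_sym:
  fixes P :: "'v::finite \<Rightarrow> 'v pmf"
  assumes "stationary P \<pi>"
  shows "flow P \<pi> (- A) A = flow P \<pi> A (- A)"
proof -
  have "flow P \<pi> A A + flow P \<pi> (- A) A = (\<Sum>y\<in>A. pmf \<pi> y)"
    unfolding flow_Compl[OF assms, of A, symmetric] sum.distrib sum_flow_singleton ..
  moreover have "flow P \<pi> A A + flow P \<pi> A (- A) = (\<Sum>y\<in>A. pmf \<pi> y)"
    using sum_Compl[of "\<lambda>y. flow P \<pi> A {y}" A]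
    by (simp add: sum_flow_singleton flow_UNIV measure_measure_pmf_finite)
  ultimately show ?thesis by simp
qed

lemma lazy_flow_ge:
  fixes P :: "'v::finite \<Rightarrow> 'v pmf"
  assumes "lazy_chain P" and "y \<in> A"
  shows "flow P \<pi> A {y} \<ge> pmf \<pi> y / 2"
proof -
  have "pmf \<pi> y * (1 / 2) \<le> pmf \<pi> y * pmf (P y) y"
    using assms(1) unfolding lazy_chain_def by (intro mult_left_mono) auto
  also have "\<dots> \<le> flow P \<pi> A {y}"
    unfolding flow_singleton
    by (rule member_le_sum[of y A "\<lambda>x. pmf \<pi> x * pmf (P x) y"]) (use assms in auto)
  finally show ?thesis by simp
qed

lemma lazy_flow_le:
  fixes P :: "'v::finite \<Rightarrow> 'v pmf"
  assumes "lazy_chain P" and "stationary P \<pi>" and "y \<notin> A"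
  shows "flow P \<pi> A {y} \<le> pmf \<pi> y / 2"
  using lazy_flow_ge[OF assms(1), of y "- A" \<pi>] flow_Compl[OF assms(2), of A y] assms(3) by simp

section \<open>The measure of the evolving sets and its integrals\<close>

lemma prob_evolve:
  fixes P :: "'v::finite \<Rightarrow> 'v pmf"
  shows "measure_pmf.prob \<pi> (evolve P \<pi> A u)
         = (\<Sum>y\<in>UNIV. if u * pmf \<pi> y \<le> flow P \<pi> A {y} then pmf \<pi> y else 0)"
  by (simp add: measure_measure_pmf_finite evolve_def sum.If_cases)

lemma borel_measurable_prob_evolve:
  fixes P :: "'v::finite \<Rightarrow> 'v pmf"
  shows "(\<lambda>u. measure_pmf.prob \<pi> (evolve P \<pi> A u)) \<in> borel_measurable borel"
  unfolding prob_evolve by measurable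

lemma finite_range_prob_evolve:
  fixes P :: "'v::finite \<Rightarrow> 'v pmf"
  shows "finite (range (\<lambda>u. measure_pmf.prob \<pi> (evolve P \<pi> A u)))"
  by (rule finite_subset[of _ "range (measure_pmf.prob \<pi>)"]) auto

definition evolve_area :: "('v::finite \<Rightarrow> 'v pmf) \<Rightarrow> 'v pmf \<Rightarrow> 'v set \<Rightarrow> real \<Rightarrow> real" where
  "evolve_area P \<pi> A c = (\<Sum>y\<in>UNIV. min (c * pmf \<pi> y) (flow P \<pi> A {y}))"

text \<open>A vertex \<open>y\<close> belongs to the evolved set exactly up to the threshold Q(A, y)
  / \<pi>(y). It therefore contributes \<pi>(y) times the length of [0, c] below that
  threshold.\<close>

lemma has_integral_prob_evolve_0:
  fixes P :: "'v::finite \<Rightarrow> 'v pmf"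
  assumes pos: "\<And>y. pmf \<pi> y > 0" and "0 \<le> c"
  shows "((\<lambda>u. measure_pmf.prob \<pi> (evolve P \<pi> A u)) has_integral evolve_area P \<pi> A c) {0..c}"
  unfolding prob_evolve evolve_area_def
proof (intro has_integral_sum finite)
  fix y :: 'v
  let ?d = "min c (flow P \<pi> A {y} / pmf \<pi> y)"
  have "?d \<ge> 0"
    using assms by (simp add: flow_nonneg)
  moreover have "?d * pmf \<pi> y = min (c * pmf \<pi> y) (flow P \<pi> A {y})"
    using pos[of y] by (auto simp: min_def field_simps)
  ultimately have "((\<lambda>_. pmf \<pi> y) has_integral min (c * pmf \<pi> y) (flow P \<pi> A {y})) {0..?d}"
    using has_integral_const_real[of "pmf \<pi> y" 0 ?d] by simp
  then have "((\<lambda>u. if u \<in> {0..?d} then pmf \<pi> y else 0) has_integral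
               min (c * pmf \<pi> y) (flow P \<pi> A {y})) {0..c}"
    by (subst has_integral_restrict) auto
  then show "((\<lambda>u. if u * pmf \<pi> y \<le> flow P \<pi> A {y} then pmf \<pi> y else 0) has_integral
               min (c * pmf \<pi> y) (flow P \<pi> A {y})) {0..c}"
    using pos[of y] by (elim has_integral_eq[rotated]) (auto simp: field_simps)
qed

lemma has_integral_prob_evolve:
  fixes P :: "'v::finite \<Rightarrow> 'v pmf"
  assumes pos: "\<And>y. pmf \<pi> y > 0" and "0 \<le> c" "c \<le> d"
  shows "((\<lambda>u. measure_pmf.prob \<pi> (evolve P \<pi> A u)) has_integral
           evolve_area P \<pi> A d - evolve_area P \<pi> A c) {c..d}"
proof -
  let ?X = "\<lambda>u. measure_pmf.prob \<pi> (evolve P \<pi> A u)"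
  have F: "integral {0..b} ?X = evolve_area P \<pi> A b" "?X integrable_on {0..b}" if "0 \<le> b" for b
    using has_integral_prob_evolve_0[OF pos that] by (auto simp: integrable_on_def)
  have "?X integrable_on {c..d}"
    using F(2)[of d] assms by (auto intro: integrable_on_subinterval)
  moreover have "integral {c..d} ?X = evolve_area P \<pi> A d - evolve_area P \<pi> A c"
    using Henstock_Kurzweil_Integration.integral_combine[of 0 c d ?X] F[of c] F[of d] assms by simp
  ultimately show ?thesis
    by (metis integrable_integral)
qed

text \<open>This is the martingale property of evolving sets: for \<open>u\<close> uniform on [0, 1]
  the mean measure of the evolved set is \<pi>(A). Since Q(A, y) \<le> \<pi>(y), each minimum is
  just the flow into \<open>y\<close>.\<close>

lemma evolve_area_1:
  fixes P :: "'v::finite \<Rightarrow> 'v pmf"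
  assumes "stationary P \<pi>"
  shows "evolve_area P \<pi> A 1 = measure_pmf.prob \<pi> A"
proof -
  have "min (1 * pmf \<pi> y) (flow P \<pi> A {y}) = flow P \<pi> A {y}" for y
    using flow_Compl[OF assms, of A y] flow_nonneg[of P \<pi> "- A" "{y}"] by simp
  then show ?thesis
    unfolding evolve_area_def by (simp add: sum_flow_singleton flow_UNIV)
qed

text \<open>By laziness a vertex of \<open>A\<close> stays in the evolved set for all levels up to
  1/2, so it contributes its full share. The excess over \<open>s\<close> times \<pi>(A) comes from
  the vertices outside \<open>A\<close>.\<close>

lemma evolve_area_lower:
  fixes P :: "'v::finite \<Rightarrow> 'v pmf"
  assumes "lazy_chain P" and "s \<le> 1 / 2"
  shows "evolve_area P \<pi> A s
         = s * measure_pmf.prob \<pi> A + (\<Sum>y\<in>- A. min (s * pmf \<pi> y) (flow P \<pi> A {y}))"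
proof -
  have "min (s * pmf \<pi> y) (flow P \<pi> A {y}) = s * pmf \<pi> y" if "y \<in> A" for y
    using lazy_flow_ge[OF assms(1) that, of \<pi>] mult_right_mono[OF assms(2), of "pmf \<pi> y"] by simp
  then show ?thesis
    unfolding evolve_area_def
    by (simp add: measure_measure_pmf_finite sum_distrib_left flip: sum_Compl[of _ A])
qed

text \<open>On the top levels, laziness removes all contribution from outside \<open>A\<close>. A
  vertex of \<open>A\<close> has threshold 1 - Q(-A, y) / \<pi>(y), so what it loses is governed by
  the flow from the complement.\<close>

lemma evolve_area_upper:
  fixes P :: "'v::finite \<Rightarrow> 'v pmf"
  assumes "lazy_chain P" and "stationary P \<pi>" and "s \<le> 1 / 2"
  shows "evolve_area P \<pi> A 1 - evolve_area P \<pi> A (1 - s)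
         = s * measure_pmf.prob \<pi> A - (\<Sum>y\<in>A. min (s * pmf \<pi> y) (flow P \<pi> (- A) {y}))"
proof -
  define d where "d y = min (1 * pmf \<pi> y) (flow P \<pi> A {y}) - min ((1 - s) * pmf \<pi> y) (flow P \<pi> A {y})" for y
  have le: "flow P \<pi> A {y} \<le> pmf \<pi> y" for y
    using flow_Compl[OF assms(2), of A y] flow_nonneg[of P \<pi> "- A" "{y}"] by simp
  have out: "d y = 0" if "y \<notin> A" for y
    using lazy_flow_le[OF assms(1,2) that] le[of y]
      mult_right_mono[OF assms(3), of "pmf \<pi> y"] by (simp add: d_def algebra_simps)
  have ins: "d y = s * pmf \<pi> y - min (s * pmf \<pi> y) (flow P \<pi> (- A) {y})" for y
    using flow_Compl[OF assms(2), of A y] le[of y] by (auto simp: d_def min_def algebra_simps)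
  have "evolve_area P \<pi> A 1 - evolve_area P \<pi> A (1 - s) = sum d A + sum d (- A)"
    unfolding sum_Compl d_def evolve_area_def by (simp only: sum_subtractf)
  also have "sum d (- A) = 0"
    using out by simp
  also have "sum d A = s * measure_pmf.prob \<pi> A - (\<Sum>y\<in>A. min (s * pmf \<pi> y) (flow P \<pi> (- A) {y}))"
    unfolding ins by (simp add: sum_subtractf measure_measure_pmf_finite sum_distrib_left)
  finally show ?thesis by simp
qed

text \<open>The sums in \<open>up\<close> and \<open>down\<close> are the excess and the deficit of
  area on the lowest and highest \<open>s\<close> levels. They place the mean measure at or above
  \<open>a + t\<close> on the former and at or below \<open>a - t\<close> on the latter, as
  \<open>integral_concave_le_spread\<close> requires.\<close>

lemma integral_evolve_le_spread:
  fixes P :: "'v::finite \<Rightarrow> 'v pmf"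
  assumes pos: "\<And>y. pmf \<pi> y > 0" and P: "lazy_chain P" "stationary P \<pi>"
    and A: "A \<noteq> {}" "A \<noteq> UNIV" and f: "concave_on {0..1} f"
    and s: "0 < s" "s \<le> 1 / 2" and "0 \<le> t"
    and up: "s * t \<le> (\<Sum>y\<in>- A. min (s * pmf \<pi> y) (flow P \<pi> A {y}))"
    and down: "s * t \<le> (\<Sum>y\<in>A. min (s * pmf \<pi> y) (flow P \<pi> (- A) {y}))"
  defines "a \<equiv> measure_pmf.prob \<pi> A"
  shows "a + t \<le> 1" and "0 \<le> a - t"
    and "integral {0..1} (\<lambda>u. f (measure_pmf.prob \<pi> (evolve P \<pi> A u)))
         \<le> (1 - 2 * s) * f a + s * (f (a + t) + f (a - t))"
proof -
  have "a > 0"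
    unfolding a_def measure_measure_pmf_finite[OF finite] using A(1) pos by (intro sum_pos) auto
  moreover have "a + measure_pmf.prob \<pi> (- A) = 1"
    by (simp add: a_def measure_measure_pmf_finite sum_Compl sum_pmf_eq_1)
  moreover have "measure_pmf.prob \<pi> (- A) > 0"
    unfolding measure_measure_pmf_finite[OF finite] using A(2) pos by (intro sum_pos) auto
  ultimately have a: "a \<in> {0<..<1}"
    by simp
  have range: "range (\<lambda>u. measure_pmf.prob \<pi> (evolve P \<pi> A u)) \<subseteq> {0..1}"
    by auto
  have I1: "((\<lambda>u. measure_pmf.prob \<pi> (evolve P \<pi> A u)) has_integral evolve_area P \<pi> A s) {0..s}"
    using has_integral_prob_evolve_0[OF pos] s by simp
  have I2: "((\<lambda>u. measure_pmf.prob \<pi> (evolve P \<pi> A u)) has_integral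
               evolve_area P \<pi> A (1 - s) - evolve_area P \<pi> A s) {s..1 - s}"
    using s by (intro has_integral_prob_evolve[OF pos]) auto
  have I3: "((\<lambda>u. measure_pmf.prob \<pi> (evolve P \<pi> A u)) has_integral
               evolve_area P \<pi> A 1 - evolve_area P \<pi> A (1 - s)) {1 - s..1}"
    using s by (intro has_integral_prob_evolve[OF pos]) auto
  have le1: "s * (a + t) \<le> evolve_area P \<pi> A s"
    using up by (simp add: evolve_area_lower[OF P(1) s(2)] a_def algebra_simps)
  have le3: "evolve_area P \<pi> A 1 - evolve_area P \<pi> A (1 - s) \<le> s * (a - t)"
    using down by (simp add: evolve_area_upper[OF P s(2)] a_def algebra_simps)
  have sum: "evolve_area P \<pi> A s + (evolve_area P \<pi> A (1 - s) - evolve_area P \<pi> A s)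
      + (evolve_area P \<pi> A 1 - evolve_area P \<pi> A (1 - s)) = a"
    by (simp add: evolve_area_1[OF P(2)] a_def)
  note spread = integral_concave_le_spread[OF finite_range_prob_evolve borel_measurable_prob_evolve
      range f a less_imp_le[OF s(1)] s(2) \<open>0 \<le> t\<close> I1 le1 I2 I3 le3 sum s(1)]
  show "a + t \<le> 1" "0 \<le> a - t"
    "integral {0..1} (\<lambda>u. f (measure_pmf.prob \<pi> (evolve P \<pi> A u)))
         \<le> (1 - 2 * s) * f a + s * (f (a + t) + f (a - t))"
    by (rule spread)+
qed

section \<open>Paths across a cut and the congestion constants\<close>

text \<open>The first arc with head outside \<open>B\<close> is such an arc. Its head is recorded as
  a visited vertex so that one crossing can be charged both to an edge and to a vertex.\<close>

lemma awalk_crossing: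
  assumes "pre_digraph.awalk (chain_graph P) x p y" and "x \<in> B" and "y \<notin> B"
  obtains e where "e \<in> set p" "e \<in> edge_set P" "fst e \<in> B" "snd e \<notin> B"
    "snd e \<in> set (pre_digraph.awalk_verts (chain_graph P) x p)"
proof -
  let ?G = "chain_graph P"
  have cross: "\<exists>e\<in>set p. fst e \<in> B \<and> snd e \<notin> B \<and> snd e \<in> set (pre_digraph.awalk_verts ?G x p)"
    if "pre_digraph.cas ?G x p y" "x \<in> B" for x
    using that
  proof (induction p arbitrary: x)
    case Nil
    then show ?case using \<open>y \<notin> B\<close> by (simp add: pre_digraph.cas.simps)
  next
    case (Cons e p)
    then have e: "fst e = x" "pre_digraph.cas ?G (snd e) p y"
      by (auto simp: pre_digraph.cas.simps chain_graph_def)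
    show ?case
    proof (cases "snd e \<in> B")
      case True
      then show ?thesis
        using Cons.IH[OF e(2)] by (auto simp: pre_digraph.awalk_verts.simps chain_graph_def)
    next
      case False
      \<comment> \<open>The walk \<open>p\<close> starts at \<open>snd e\<close>. The case split is
        needed because \<open>awalk_verts\<close> lists the tail of the first arc when there is one,
        and \<open>cas\<close> identifies it with the start.\<close>
      have "snd e \<in> set (pre_digraph.awalk_verts ?G (snd e) p)"
        using e(2) by (cases p) (auto simp: pre_digraph.awalk_verts.simps pre_digraph.cas.simps)
      then show ?thesis
        using False e(1) Cons.prems by (auto simp: pre_digraph.awalk_verts.simps chain_graph_def)
    qed
  qed
  have "pre_digraph.cas ?G x p y" "set p \<subseteq> edge_set P"
    using assms(1) by (auto simp: pre_digraph.awalk_def chain_graph_def)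
  with cross assms(2) that show thesis
    by blast
qed

lemma edge_weight_nonneg: "edge_weight P \<pi> e \<ge> 0"
  by (simp add: edge_weight_def)

lemma edge_weight_pos:
  assumes "\<And>y. pmf \<pi> y > 0" and "e \<in> edge_set P"
  shows "edge_weight P \<pi> e > 0"
  using assms by (auto simp: edge_weight_def edge_set_def)

lemma sum_edge_weight_via_edge_le:
  assumes "\<And>y. pmf \<pi> y > 0" and "e \<in> edge_set P"
  shows "(\<Sum>d\<in>pairs_via_edge P' \<gamma> e. edge_weight P' \<pi>' d) \<le> rho_edge P \<pi> P' \<pi>' \<gamma> * edge_weight P \<pi> e"
proof -
  have "1 / edge_weight P \<pi> e * (\<Sum>d\<in>pairs_via_edge P' \<gamma> e. edge_weight P' \<pi>' d)
        \<le> rho_edge P \<pi> P' \<pi>' \<gamma>"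
    unfolding rho_edge_def by (rule Max_ge) (use assms(2) in auto)
  then show ?thesis
    using edge_weight_pos[OF assms] by (simp add: field_simps)
qed

text \<open>Every vertex has an outgoing edge because its transition probabilities sum to 1, so the
  maximum dominates at least one nonnegative term.\<close>

lemma rho_edge_nonneg:
  fixes P :: "'v::finite \<Rightarrow> 'v pmf"
  shows "rho_edge P \<pi> P' \<pi>' \<gamma> \<ge> 0"
proof -
  obtain y where "y \<in> set_pmf (P undefined)"
    using set_pmf_not_empty[of "P undefined"] by blast
  then have e: "(undefined, y) \<in> edge_set P"
    by (simp add: edge_set_def pmf_positive)
  have "0 \<le> 1 / edge_weight P \<pi> (undefined, y)
          * (\<Sum>d\<in>pairs_via_edge P' \<gamma> (undefined, y). edge_weight P' \<pi>' d)"
    by (intro mult_nonneg_nonneg sum_nonneg) (auto simp: edge_weight_nonneg)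
  also have "\<dots> \<le> rho_edge P \<pi> P' \<pi>' \<gamma>"
    unfolding rho_edge_def by (rule Max_ge) (use e in auto)
  finally show ?thesis .
qed

text \<open>Each crossing pair is assigned one crossing edge of its path, and the pairs are grouped
  by the head \<open>y\<close> of that edge. All paths in a group visit \<open>y\<close>, which
  gives the first bound; splitting the group by tails gives the second. The assumption on \<rho>
  concerns only families crossing from \<open>B\<close> to its complement, so that both vertex
  constants satisfy it.\<close>

lemma flow_cut_le:
  fixes P P' :: "'v::finite \<Rightarrow> 'v pmf"
  assumes pos: "\<And>y. pmf \<pi> y > 0" and \<gamma>: "path_system P P' \<gamma>"
    and \<rho>: "\<And>v D. D \<subseteq> pairs_via_vertex P P' \<gamma> v \<Longrightarrow> D \<subseteq> B \<times> - B
                \<Longrightarrow> sum (edge_weight P' \<pi>') D \<le> \<rho> * pmf \<pi> v"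
  shows "flow P' \<pi>' B (- B)
         \<le> (\<Sum>y\<in>- B. min (\<rho> * pmf \<pi> y) (rho_edge P \<pi> P' \<pi>' \<gamma> * flow P \<pi> B {y}))"
proof -
  let ?w = "edge_weight P' \<pi>'" and ?re = "rho_edge P \<pi> P' \<pi>' \<gamma>"
  \<comment> \<open>Only pairs in the edge set of \<open>P'\<close> have a prescribed path; the
    remaining pairs carry no weight.\<close>
  define D where "D = edge_set P' \<inter> B \<times> - B"
  have "\<exists>e. e \<in> set (\<gamma> x y) \<and> e \<in> edge_set P \<and> fst e \<in> B \<and> snd e \<notin> B
          \<and> (x, y) \<in> pairs_via_vertex P P' \<gamma> (snd e)" if "(x, y) \<in> D" for x y
  proof -
    have "pre_digraph.awalk (chain_graph P) x (\<gamma> x y) y" "x \<in> B" "y \<notin> B" "(x, y) \<in> edge_set P'"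
      using \<gamma> that by (auto simp: path_system_def D_def)
    then obtain e where "e \<in> set (\<gamma> x y)" "e \<in> edge_set P" "fst e \<in> B" "snd e \<notin> B"
      "snd e \<in> set (pre_digraph.awalk_verts (chain_graph P) x (\<gamma> x y))"
      using awalk_crossing by metis
    then show ?thesis
      using \<open>(x, y) \<in> edge_set P'\<close> unfolding pairs_via_vertex_def by blast
  qed
  then have "\<forall>d\<in>D. \<exists>e. e \<in> set (\<gamma> (fst d) (snd d)) \<and> e \<in> edge_set P \<and> fst e \<in> B \<and> snd e \<notin> B
               \<and> d \<in> pairs_via_vertex P P' \<gamma> (snd e)"
    by auto
  then obtain c where c: "\<And>d. d \<in> D \<Longrightarrow> c d \<in> set (\<gamma> (fst d) (snd d)) \<and> c d \<in> edge_set P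
      \<and> fst (c d) \<in> B \<and> snd (c d) \<notin> B \<and> d \<in> pairs_via_vertex P P' \<gamma> (snd (c d))"
    by metis
  have "flow P' \<pi>' B (- B) = sum ?w (B \<times> - B)"
    by (simp add: flow_def sum.cartesian_product edge_weight_def case_prod_unfold)
  also have "\<dots> = sum ?w D"
    by (rule sum.mono_neutral_right)
      (auto simp: D_def edge_weight_def edge_set_def not_less pmf_positive_iff set_pmf_iff)
  also have "\<dots> = (\<Sum>y\<in>- B. sum ?w {d \<in> D. snd (c d) = y})"
    using c by (intro sum.group[symmetric]) auto
  also have "\<dots> \<le> (\<Sum>y\<in>- B. min (\<rho> * pmf \<pi> y) (?re * flow P \<pi> B {y}))"
  proof (intro sum_mono min.boundedI)
    fix y
    show "sum ?w {d \<in> D. snd (c d) = y} \<le> \<rho> * pmf \<pi> y"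
      using c by (intro \<rho>) (auto simp: D_def)
    have "sum ?w {d \<in> D. snd (c d) = y} = (\<Sum>x\<in>B. sum ?w {d \<in> {d \<in> D. snd (c d) = y}. fst (c d) = x})"
      using c by (intro sum.group[symmetric]) auto
    also have "\<dots> \<le> (\<Sum>x\<in>B. ?re * edge_weight P \<pi> (x, y))"
    proof (rule sum_mono)
      fix x
      let ?D = "{d \<in> {d \<in> D. snd (c d) = y}. fst (c d) = x}"
      have cd: "c d = (x, y)" if "d \<in> ?D" for d
        using that by (auto simp: prod_eq_iff)
      show "sum ?w ?D \<le> ?re * edge_weight P \<pi> (x, y)"
      proof (cases "(x, y) \<in> edge_set P")
        case True
        have "?D \<subseteq> pairs_via_edge P' \<gamma> (x, y)"
        proof
          fix d assume d: "d \<in> ?D"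
          then have "(x, y) \<in> set (\<gamma> (fst d) (snd d))" "d \<in> edge_set P'"
            using c[of d] cd[OF d] by (auto simp: D_def)
          then show "d \<in> pairs_via_edge P' \<gamma> (x, y)"
            by (auto simp: pairs_via_edge_def)
        qed
        then have "sum ?w ?D \<le> sum ?w (pairs_via_edge P' \<gamma> (x, y))"
          by (intro sum_mono2) (auto simp: edge_weight_nonneg)
        also have "\<dots> \<le> ?re * edge_weight P \<pi> (x, y)"
          by (rule sum_edge_weight_via_edge_le[OF pos True])
        finally show ?thesis .
      next
        case False
        have "d \<notin> ?D" for d
        proof
          assume d: "d \<in> ?D"
          then have "c d \<in> edge_set P"
            by (simp add: c)
          with cd[OF d] False show False
            by simp
        qed
        then have "?D = {}"
          by blast
        then have "sum ?w ?D = 0"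
          by (simp only: sum.empty)
        then show ?thesis
          by (simp only: mult_nonneg_nonneg rho_edge_nonneg edge_weight_nonneg)
      qed
    qed
    also have "\<dots> = ?re * flow P \<pi> B {y}"
      by (simp add: flow_singleton edge_weight_def sum_distrib_left)
    finally show "sum ?w {d \<in> D. snd (c d) = y} \<le> ?re * flow P \<pi> B {y}" .
  qed
  finally show ?thesis .
qed

lemma sum_edge_weight_le_rho_vertex:
  fixes P P' :: "'v::finite \<Rightarrow> 'v pmf"
  assumes pos: "\<And>y. pmf \<pi> y > 0" and "D \<subseteq> pairs_via_vertex P P' \<gamma> v"
  shows "sum (edge_weight P' \<pi>') D \<le> rho_vertex P \<pi> P' \<pi>' \<gamma> * pmf \<pi> v"
proof -
  have "sum (edge_weight P' \<pi>') D \<le> sum (edge_weight P' \<pi>') (pairs_via_vertex P P' \<gamma> v)"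
    using assms(2) by (intro sum_mono2) (auto simp: edge_weight_nonneg)
  moreover have "1 / pmf \<pi> v * sum (edge_weight P' \<pi>') (pairs_via_vertex P P' \<gamma> v)
      \<le> rho_vertex P \<pi> P' \<pi>' \<gamma>"
    unfolding rho_vertex_def by (rule Max_ge) auto
  ultimately show ?thesis
    using pos[of v] by (simp add: field_simps)
qed

text \<open>A set of pairs crossing from \<open>B\<close> to its complement never contains both orientations of a
  pair, so the smaller constant suffices for it.\<close>

lemma sum_edge_weight_le_rho_vertex_max:
  fixes P P' :: "'v::finite \<Rightarrow> 'v pmf"
  assumes pos: "\<And>y. pmf \<pi> y > 0" and D: "D \<subseteq> pairs_via_vertex P P' \<gamma> v" "D \<subseteq> B \<times> - B"
  shows "sum (edge_weight P' \<pi>') D \<le> rho_vertex_max P \<pi> P' \<pi>' \<gamma> * pmf \<pi> v"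
proof -
  let ?w = "edge_weight P' \<pi>'" and ?V = "pairs_via_vertex P P' \<gamma> v"
  let ?u = "\<lambda>(x, y). {x, y} :: 'v set"
  let ?m = "\<lambda>S. MAX d\<in>{(x, y) \<in> ?V. {x, y} = S}. ?w d"
  have le: "?w d \<le> ?m (?u d)" if "d \<in> ?V" for d
    by (rule Max_ge) (use that in auto)
  have "inj_on ?u D"
  proof (rule inj_onI)
    fix d d' assume "d \<in> D" "d' \<in> D" "?u d = ?u d'"
    moreover have "d \<in> B \<times> - B" "d' \<in> B \<times> - B"
      using D(2) \<open>d \<in> D\<close> \<open>d' \<in> D\<close> by auto
    ultimately show "d = d'"
      by (auto simp: doubleton_eq_iff)
  qed
  then have "(\<Sum>d\<in>D. ?m (?u d)) = (\<Sum>S\<in>?u ` D. ?m S)"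
    by (simp add: sum.reindex)
  moreover have "sum ?w D \<le> (\<Sum>d\<in>D. ?m (?u d))"
    using D(1) le by (intro sum_mono) auto
  moreover have "(\<Sum>S\<in>?u ` D. ?m S) \<le> (\<Sum>S\<in>?u ` ?V. ?m S)"
  proof (rule sum_mono2)
    fix S assume "S \<in> ?u ` ?V - ?u ` D"
    then obtain d where "d \<in> ?V" "S = ?u d" by blast
    then show "0 \<le> ?m S"
      using order_trans[OF edge_weight_nonneg le] by blast
  qed (use D(1) in auto)
  moreover have "1 / pmf \<pi> v * (\<Sum>S\<in>?u ` ?V. ?m S) \<le> rho_vertex_max P \<pi> P' \<pi>' \<gamma>"
    unfolding rho_vertex_max_def by (rule Max_ge) auto
  ultimately show ?thesis
    using pos[of v] by (simp add: field_simps)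
qed

section \<open>The bound on the profile\<close>

text \<open>The constant \<rho> is any bound for crossing families, so the two vertex constants are
  both instances. With \<open>s = \<rho> / \<rho>\<^sub>e\<close> and \<open>t = q / \<rho>\<close>,
  the claim after multiplication by \<open>f a\<close> reads
  \<open>?I \<le> (1 - 2 * s) * f a + s * (f (a + t) + f (a - t))\<close>.\<close>

lemma C_profile_le:
  fixes P P' :: "'v::finite \<Rightarrow> 'v pmf"
  assumes P: "irreducible_chain P" "stationary P \<pi>" and P': "stationary P' \<pi>'"
    and \<gamma>: "path_system P P' \<gamma>" and lazy: "lazy_chain P"
    and A: "A \<noteq> {}" "A \<noteq> UNIV"
    and f: "concave_on {0..1} f" "\<forall>t\<in>{0..1}. f t \<ge> 0" "f (measure_pmf.prob \<pi> A) \<noteq> 0"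
    and \<rho>: "\<And>B v D. D \<subseteq> pairs_via_vertex P P' \<gamma> v \<Longrightarrow> D \<subseteq> B \<times> - B
                \<Longrightarrow> sum (edge_weight P' \<pi>') D \<le> \<rho> * pmf \<pi> v"
  defines "a \<equiv> measure_pmf.prob \<pi> A" and "q \<equiv> flow P' \<pi>' A (- A)"
    and "\<rho>\<^sub>e \<equiv> rho_edge P \<pi> P' \<pi>' \<gamma>"
  shows "1 - C_profile P \<pi> f A \<ge> 2 * (\<rho> / \<rho>\<^sub>e) * (1 - (f (a + q / \<rho>) + f (a - q / \<rho>)) / (2 * f a))"
proof -
  note pos = stationary_pmf_pos[OF P]
  let ?I = "integral {0..1} (\<lambda>u. f (measure_pmf.prob \<pi> (evolve P \<pi> A u)))"
  have fa: "f a > 0"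
    using f(2,3) by (force simp: a_def less_le)
  have q: "q \<ge> 0"
    by (simp add: q_def flow_nonneg)
  have "\<rho>\<^sub>e \<ge> 0"
    by (simp add: \<rho>\<^sub>e_def rho_edge_nonneg)
  have "\<rho> \<ge> 0"
    using \<rho>[of "{}" undefined A] pos[of undefined] by (simp add: zero_le_mult_iff)
  note spread = integral_evolve_le_spread[OF pos lazy P(2) A f(1), folded a_def]
  have half: "x \<le> pmf \<pi> y / 2 \<Longrightarrow> \<rho>\<^sub>e * x \<le> \<rho>\<^sub>e / 2 * pmf \<pi> y" for x y
    using mult_left_mono[OF _ \<open>\<rho>\<^sub>e \<ge> 0\<close>, of x "pmf \<pi> y / 2"] by simp
  \<comment> \<open>For \<open>B = A\<close> and \<open>B = - A\<close> these are the hypotheses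
    \<open>up\<close> and \<open>down\<close> with spread \<open>q / (\<rho>\<^sub>e * s)\<close>.
    At \<open>s = 1 / 2\<close> the vertex bound is replaced by laziness, which limits the flow into
    a vertex outside \<open>B\<close> to half its mass.\<close>
  have cut: "s * (q / (\<rho>\<^sub>e * s)) \<le> (\<Sum>y\<in>- B. min (s * pmf \<pi> y) (flow P \<pi> B {y}))"
    if "B = A \<or> B = - A" and s: "\<rho> \<le> \<rho>\<^sub>e * s \<or> s = 1 / 2" "s > 0" "\<rho>\<^sub>e > 0" for B s
  proof -
    have "q = flow P' \<pi>' B (- B)"
      using that(1) flow_cut_sym[OF P', of A] by (auto simp: q_def)
    also have "\<dots> \<le> (\<Sum>y\<in>- B. min (\<rho> * pmf \<pi> y) (\<rho>\<^sub>e * flow P \<pi> B {y}))"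
      unfolding \<rho>\<^sub>e_def by (rule flow_cut_le[OF pos \<gamma> \<rho>])
    also have "\<dots> \<le> (\<Sum>y\<in>- B. \<rho>\<^sub>e * min (s * pmf \<pi> y) (flow P \<pi> B {y}))"
    proof (rule sum_mono)
      fix y assume "y \<in> - B"
      then have "\<rho>\<^sub>e * flow P \<pi> B {y} \<le> \<rho>\<^sub>e * s * pmf \<pi> y" if "s = 1 / 2"
        using half[OF lazy_flow_le[OF lazy P(2), of y B]] unfolding that by simp
      moreover have "\<rho> * pmf \<pi> y \<le> \<rho>\<^sub>e * s * pmf \<pi> y" if "\<rho> \<le> \<rho>\<^sub>e * s"
        using that by (intro mult_right_mono) auto
      moreover have "\<rho>\<^sub>e * min (s * pmf \<pi> y) (flow P \<pi> B {y})
          = min (\<rho>\<^sub>e * s * pmf \<pi> y) (\<rho>\<^sub>e * flow P \<pi> B {y})"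
        using s(3) by (simp add: min_mult_distrib_left mult.assoc)
      ultimately show "min (\<rho> * pmf \<pi> y) (\<rho>\<^sub>e * flow P \<pi> B {y})
          \<le> \<rho>\<^sub>e * min (s * pmf \<pi> y) (flow P \<pi> B {y})"
        using s(1) by (auto simp: min_le_iff_disj)
    qed
    finally have "q \<le> \<rho>\<^sub>e * (\<Sum>y\<in>- B. min (s * pmf \<pi> y) (flow P \<pi> B {y}))"
      by (simp add: sum_distrib_left)
    then show ?thesis
      using s by (simp add: field_simps)
  qed
  have spread_s: "a + q / (\<rho>\<^sub>e * s) \<le> 1 \<and> 0 \<le> a - q / (\<rho>\<^sub>e * s)
      \<and> ?I \<le> (1 - 2 * s) * f a + s * (f (a + q / (\<rho>\<^sub>e * s)) + f (a - q / (\<rho>\<^sub>e * s)))"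
    if s: "\<rho> \<le> \<rho>\<^sub>e * s \<or> s = 1 / 2" "0 < s" "s \<le> 1 / 2" "\<rho>\<^sub>e > 0" for s
  proof -
    have t: "0 \<le> q / (\<rho>\<^sub>e * s)"
      using q s by simp
    show ?thesis
      using spread[OF s(2,3) t cut[of A s] cut[of "- A" s, unfolded double_compl]] s by auto
  qed
  have "?I \<le> (1 - 2 * (\<rho> / \<rho>\<^sub>e)) * f a + \<rho> / \<rho>\<^sub>e * (f (a + q / \<rho>) + f (a - q / \<rho>))"
  proof (cases "\<rho> / \<rho>\<^sub>e = 0")
    case True
    \<comment> \<open>Division by zero yields 0, so this case covers both vanishing constants. The
      claim becomes \<open>?I \<le> f a\<close>, which is the spread inequality with
      \<open>s = 1 / 2\<close> and \<open>t = 0\<close>.\<close>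
    have "0 \<le> (\<Sum>y\<in>B. min (1 / 2 * pmf \<pi> y) (flow P \<pi> (- B) {y}))" for B
      by (intro sum_nonneg) (auto simp: flow_nonneg)
    from spread(3)[of "1 / 2" 0] this[of A] this[of "- A"] show ?thesis
      unfolding True by simp
  next
    case False
    then have nz: "\<rho> > 0" "\<rho>\<^sub>e > 0"
      using \<open>\<rho> \<ge> 0\<close> \<open>\<rho>\<^sub>e \<ge> 0\<close> by auto
    define s where "s = \<rho> / \<rho>\<^sub>e"
    have s: "s > 0" "\<rho>\<^sub>e * s = \<rho>"
      using nz by (auto simp: s_def)
    show ?thesis
    proof (cases "s \<le> 1 / 2")
      case True
      then show ?thesis
        using spread_s[of s] s nz by (simp add: s_def)
    next
      case big: False
      \<comment> \<open>The spread inequality is used at \<open>s = 1 / 2\<close>, with the wider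
        displacement \<open>t'\<close>. Since \<open>t = \<theta> * t'\<close>, the points
        \<open>a + t\<close> and \<open>a - t\<close> lie between \<open>a\<close> and the outer
        points, and concavity weighted by \<open>s\<close>, with
        \<open>s * \<theta> = 1 / 2\<close>, transfers the bound to them.\<close>
      define t where "t = q / \<rho>"
      define \<theta> where "\<theta> = 1 / (2 * s)"
      have \<theta>: "0 \<le> \<theta>" "\<theta> \<le> 1" "s * \<theta> = 1 / 2"
        using big by (auto simp: \<theta>_def)
      define t' where "t' = q / (\<rho>\<^sub>e * (1 / 2))"
      have t: "t = \<theta> * t'"
        using s nz by (simp add: t_def t'_def \<theta>_def flip: s(2))
      have le: "a + t' \<le> 1" "0 \<le> a - t'"
        and I: "?I \<le> 1 / 2 * (f (a + t') + f (a - t'))"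
        using spread_s[of "1 / 2"] nz by (auto simp: t'_def)
      have "t' \<ge> 0"
        using q nz by (simp add: t'_def)
      have conc: "s * ((1 - \<theta>) * f a + \<theta> * f x) \<le> s * f ((1 - \<theta>) * a + \<theta> * x)"
        if "x \<in> {0..1}" for x
        using concave_onD[OF f(1) \<theta>(1,2), of a x] that s(1)
        by (intro mult_left_mono) (auto simp: a_def)
      have conc': "(s - 1 / 2) * f a + 1 / 2 * f x \<le> s * f ((1 - \<theta>) * a + \<theta> * x)"
        if "x \<in> {0..1}" for x
      proof -
        have "s * ((1 - \<theta>) * f a + \<theta> * f x) = (s - s * \<theta>) * f a + s * \<theta> * f x"
          by (simp add: algebra_simps)
        then show ?thesis using conc[OF that] \<theta>(3) by simp
      qed
      have "(1 - \<theta>) * a + \<theta> * (a + t') = a + t" "(1 - \<theta>) * a + \<theta> * (a - t') = a - t"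
        by (simp_all add: t algebra_simps)
      moreover have "a + t' \<in> {0..1}" "a - t' \<in> {0..1}"
        using le \<open>t' \<ge> 0\<close> by auto
      ultimately have "(s - 1 / 2) * f a + 1 / 2 * f (a + t') \<le> s * f (a + t)"
        "(s - 1 / 2) * f a + 1 / 2 * f (a - t') \<le> s * f (a - t)"
        using conc'[of "a + t'"] conc'[of "a - t'"] by auto
      then have "?I \<le> (1 - 2 * s) * f a + s * (f (a + t) + f (a - t))"
        using I by (simp add: algebra_simps)
      then show ?thesis
        by (simp add: s_def t_def)
    qed
  qed
  then have "?I / f a \<le> ((1 - 2 * (\<rho> / \<rho>\<^sub>e)) * f a + \<rho> / \<rho>\<^sub>e * (f (a + q / \<rho>) + f (a - q / \<rho>))) / f a"
    using fa by (intro divide_right_mono) auto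
  also have "\<dots> = 1 - 2 * (\<rho> / \<rho>\<^sub>e) * (1 - (f (a + q / \<rho>) + f (a - q / \<rho>)) / (2 * f a))"
    using fa by (simp add: divide_simps) (simp add: algebra_simps)
  finally show ?thesis
    by (simp add: C_profile_def a_def)
qed

theorem theorem4p4p2:
  fixes P P' :: "'v::finite \<Rightarrow> 'v pmf"
    and \<pi> \<pi>' :: "'v pmf"
    and \<gamma> :: "'v \<Rightarrow> 'v \<Rightarrow> ('v \<times> 'v) list"
    and A :: "'v set"
    and f :: "real \<Rightarrow> real"
  assumes "CARD('v) \<ge> 2"
    and "irreducible_chain P" and "stationary P \<pi>"
    and "irreducible_chain P'" and "stationary P' \<pi>'"
    and "path_system P P' \<gamma>"
    and "lazy_chain P"
    and "A \<noteq> {}" and "A \<noteq> UNIV"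
    and "concave_on {0..1} f" and "\<forall>t\<in>{0..1}. f t \<ge> 0"
    and "f (measure_pmf.prob \<pi> A) \<noteq> 0"
  shows
    "(let a = measure_pmf.prob \<pi> A;
          q = flow P' \<pi>' A (- A);
          \<rho>\<^sub>e = rho_edge P \<pi> P' \<pi>' \<gamma>;
          \<rho>\<^sub>v = rho_vertex P \<pi> P' \<pi>' \<gamma>
      in 1 - C_profile P \<pi> f A
           \<ge> 2 * (\<rho>\<^sub>v / \<rho>\<^sub>e) * (1 - (f (a + q / \<rho>\<^sub>v) + f (a - q / \<rho>\<^sub>v)) / (2 * f a)))
     \<and>
     (let a = measure_pmf.prob \<pi> A;
          q = flow P' \<pi>' A (- A);
          \<rho>\<^sub>e = rho_edge P \<pi> P' \<pi>' \<gamma>;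
          \<rho>\<^sub>v = rho_vertex_max P \<pi> P' \<pi>' \<gamma>
      in 1 - C_profile P \<pi> f A
           \<ge> 2 * (\<rho>\<^sub>v / \<rho>\<^sub>e) * (1 - (f (a + q / \<rho>\<^sub>v) + f (a - q / \<rho>\<^sub>v)) / (2 * f a)))"
  unfolding Let_def
  \<comment> \<open>The conjuncts differ only in the vertex constant; the two alternatives supply
    the bound on crossing families for each.\<close>
  by (intro conjI; rule C_profile_le[OF assms(2,3,5-12)];
      (rule sum_edge_weight_le_rho_vertex[OF stationary_pmf_pos[OF assms(2,3)]]
      | rule sum_edge_weight_le_rho_vertex_max[OF stationary_pmf_pos[OF assms(2,3)]]);
      assumption)

end
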